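(* Let $T$ be a square of side length $h>0$ with sides parallel to the coordinate axes and vertices $\mathbf{x}_1$ (lower left), $\mathbf{x}_2=\mathbf{x}_1+h\langle 1,0\rangle$, $\mathbf{x}_3=\mathbf{x}_1+h\langle 1,1\rangle$, $\mathbf{x}_4=\mathbf{x}_1+h\langle 0,1\rangle$. Let $$V_4(T)=\mathrm{span}\{P_4(T),\ b_1^{1,0},\ b_1^{2,0},\ b_2^{1,0},\ b_3^{1,0},\ b_4^{1,0}\},$$ where the $b_\ell^{i,j}$ are the nodal basis functions of the $C^1$-$Q_4$ Bell element defined in the context. Then the following 20 degrees of freedom uniquely determine the functions $p\in V_4(T)$ (that is, for every prescription of real values for these functionals there is exactly one $p\in V_4(T)$ attaining them): $$p(\mathbf{x}_i),\ \partial_x p(\mathbf{x}_i),\ \partial_y p(\mathbf{x}_i),\ \partial_{xy}p(\mathbf{x}_i),\quad i=1,2,3,4,$$ $$p\Big(\frac{\mathbf{x}_1+\mathbf{x}_2}{2}\Big),\quad p\Big(\frac{\mathbf{x}_2+\mathbf{x}_3}{2}\Big),\quad p\Big(\frac{\mathbf{x}_4+\mathbf{x}_3}{2}\Big),\quad p\Big(\frac{\mathbf{x}_1+\mathbf{x}_4}{2}\Big).$$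
   Context: $P_k(T)$ denotes the polynomials in $(x,y)$ of total degree at most $k$ restricted to $T$, and $Q_k=\mathrm{span}\{x^{k_1}y^{k_2}: 0\le k_1,k_2\le k\}$. On an edge $e$, $Q_{k-1}(e)$ is the space of univariate polynomials of degree at most $k-1$ on $e$, and $\partial_{\mathbf n}$ is the normal derivative on $e$. The $C^1$-$Q_4$ Bell element space on $T$ is $W_4(T)=\{v\in Q_4(T): \partial_{\mathbf n}v|_e\in Q_3(e) \text{ for each edge } e \text{ of } T\}$. Its (known unisolvent) 21 degrees of freedom are: (1) $v$ at $\mathbf{x}_1+\frac h2\langle i,j\rangle$, $i,j=0,1,2$; (2) $\partial_x v$ at $\mathbf{x}_1+h\langle i,j\rangle$, $i=0,1$, $j=0,1$; (3) $\partial_y v$ at $\mathbf{x}_1+h\langle i,j\rangle$, $i=0,1$, $j=0,1$; (4) $\partial_{xy}v$ at $\mathbf{x}_1+h\langle i,j\rangle$, $i,j=0,1$. The nodal basis of $W_4(T)$ dual to these degrees of freedom is denoted $b_1^{i,j}$, $b_2^{i,j}$, $b_3^{i,j}$, $b_4^{i,j}$, where $b_\ell^{i,j}\in W_4(T)$ takes value $1$ on the degree of freedom of type $(\ell)$ with index $(i,j)$ and $0$ on all other degrees of freedom in the list. *)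

theory Defs
  imports "HOL-Analysis.Analysis" "HOL-Library.Function_Algebras"
    "HOL-Computational_Algebra.Polynomial"
begin

text \<open>
  A function on \<open>T\<close> is represented by a function on the plane that vanishes outside \<open>T\<close>.
  Equality of such representatives is equality on \<open>T\<close>, and linear combinations are pointwise.
\<close>

definition on_set :: "'a set \<Rightarrow> ('a \<Rightarrow> real) \<Rightarrow> 'a \<Rightarrow> real" where
  "on_set T f = (\<lambda>z. if z \<in> T then f z else 0)"

definition fun_span :: "('a \<Rightarrow> real) set \<Rightarrow> ('a \<Rightarrow> real) set" where
  "fun_span = module.span (\<lambda>c f z. c * f z)"

definition monomial2 :: "nat \<Rightarrow> nat \<Rightarrow> real \<times> real \<Rightarrow> real" where
  "monomial2 i j = (\<lambda>(x, y). x ^ i * y ^ j)"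

definition P_space :: "nat \<Rightarrow> (real \<times> real) set \<Rightarrow> (real \<times> real \<Rightarrow> real) set" where
  "P_space k T = fun_span {on_set T (monomial2 i j) | i j. i + j \<le> k}"

definition Q_space :: "nat \<Rightarrow> (real \<times> real) set \<Rightarrow> (real \<times> real \<Rightarrow> real) set" where
  "Q_space k T = fun_span {on_set T (monomial2 i j) | i j. i \<le> k \<and> j \<le> k}"

text \<open>
  Directional derivative of a function on \<open>T\<close>. Only points of \<open>T\<close> enter the difference quotient,
  so it is one-sided at boundary points of \<open>T\<close> where necessary.
\<close>

definition dir_deriv ::
  "(real \<times> real) set \<Rightarrow> real \<times> real \<Rightarrow> (real \<times> real \<Rightarrow> real) \<Rightarrow> real \<times> real \<Rightarrow> real" where
  "dir_deriv T d f z =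
     vector_derivative (\<lambda>t. f (z + t *\<^sub>R d)) (at 0 within {t. z + t *\<^sub>R d \<in> T})"

definition dx :: "(real \<times> real) set \<Rightarrow> (real \<times> real \<Rightarrow> real) \<Rightarrow> real \<times> real \<Rightarrow> real" where
  "dx T = dir_deriv T (1, 0)"

definition dy :: "(real \<times> real) set \<Rightarrow> (real \<times> real \<Rightarrow> real) \<Rightarrow> real \<times> real \<Rightarrow> real" where
  "dy T = dir_deriv T (0, 1)"

definition dxy :: "(real \<times> real) set \<Rightarrow> (real \<times> real \<Rightarrow> real) \<Rightarrow> real \<times> real \<Rightarrow> real" where
  "dxy T v = dy T (dx T v)"

definition square :: "real \<times> real \<Rightarrow> real \<Rightarrow> (real \<times> real) set" where
  "square x1 h = cbox x1 (x1 + h *\<^sub>R (1, 1))"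

text \<open>Endpoints and outward unit normal of each edge.\<close>

definition square_edges ::
  "real \<times> real \<Rightarrow> real \<Rightarrow> ((real \<times> real) \<times> (real \<times> real) \<times> (real \<times> real)) set" where
  "square_edges x1 h =
    {(x1, x1 + h *\<^sub>R (1, 0), (0, - 1)),
     (x1 + h *\<^sub>R (1, 0), x1 + h *\<^sub>R (1, 1), (1, 0)),
     (x1 + h *\<^sub>R (0, 1), x1 + h *\<^sub>R (1, 1), (0, 1)),
     (x1, x1 + h *\<^sub>R (0, 1), (- 1, 0))}"

text \<open>
  Membership of \<open>g\<close>, restricted to the edge from \<open>A\<close> to \<open>B\<close>, in the univariate polynomials of
  degree at most \<open>k\<close>; the affine choice of parameter on the edge does not matter.
\<close>

definition poly_on_edge ::
  "nat \<Rightarrow> real \<times> real \<Rightarrow> real \<times> real \<Rightarrow> (real \<times> real \<Rightarrow> real) \<Rightarrow> bool" where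
  "poly_on_edge k A B g \<longleftrightarrow>
     (\<exists>q :: real poly. degree q \<le> k \<and> (\<forall>t\<in>{0..1}. g (A + t *\<^sub>R (B - A)) = poly q t))"

definition W4 :: "real \<times> real \<Rightarrow> real \<Rightarrow> (real \<times> real \<Rightarrow> real) set" where
  "W4 x1 h = {v \<in> Q_space 4 (square x1 h).
     \<forall>(A, B, n) \<in> square_edges x1 h. poly_on_edge 3 A B (dir_deriv (square x1 h) n v)}"

definition bell_index :: "(nat \<times> nat \<times> nat) set" where
  "bell_index = {1} \<times> {0, 1, 2} \<times> {0, 1, 2} \<union> {2, 3, 4} \<times> {0, 1} \<times> {0, 1}"

text \<open>The first index is the type of the degree of freedom; the last equation is type 4.\<close>

definition bell_dof ::
  "real \<times> real \<Rightarrow> real \<Rightarrow> nat \<Rightarrow> nat \<Rightarrow> nat \<Rightarrow> (real \<times> real \<Rightarrow> real) \<Rightarrow> real" where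
  "bell_dof x1 h l i j v =
    (if l = 1 then v (x1 + (h / 2) *\<^sub>R (real i, real j))
     else if l = 2 then dx (square x1 h) v (x1 + h *\<^sub>R (real i, real j))
     else if l = 3 then dy (square x1 h) v (x1 + h *\<^sub>R (real i, real j))
     else dxy (square x1 h) v (x1 + h *\<^sub>R (real i, real j)))"

text \<open>Well defined for \<open>h > 0\<close> and indices in \<^const>\<open>bell_index\<close>, by unisolvence of the Bell element.\<close>

definition bell_basis ::
  "real \<times> real \<Rightarrow> real \<Rightarrow> nat \<Rightarrow> nat \<Rightarrow> nat \<Rightarrow> real \<times> real \<Rightarrow> real" where
  "bell_basis x1 h l i j = (THE v. v \<in> W4 x1 h \<and>
     (\<forall>(l', i', j') \<in> bell_index.
        bell_dof x1 h l' i' j' v = (if (l', i', j') = (l, i, j) then 1 else 0)))"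

definition V4 :: "real \<times> real \<Rightarrow> real \<Rightarrow> (real \<times> real \<Rightarrow> real) set" where
  "V4 x1 h = fun_span (P_space 4 (square x1 h) \<union>
     {bell_basis x1 h 1 1 0, bell_basis x1 h 1 2 0, bell_basis x1 h 2 1 0,
      bell_basis x1 h 3 1 0, bell_basis x1 h 4 1 0})"

end

theory Submission imports Defs begin

text \<open>
  Why the theorem holds. The twenty functionals are all degrees of freedom of the Bell element
  except the value at the centre. The five basis functions added to \<open>P\<^sub>4\<close> are dual to the value,
  the two first derivatives and the mixed derivative at \<open>x\<^sub>2\<close> and to the value at the midpoint of
  the bottom edge, so they are invisible to the other fifteen functionals. The system is
  therefore block triangular: once \<open>P\<^sub>4\<close> is known to be unisolvent for the fifteen functionals
  (\<open>P4_eqI\<close>, \<open>P4_interpolation\<close>), the \<open>P\<^sub>4\<close> part of an element of \<open>V\<^sub>4\<close> is determined by them, and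
  the five remaining coefficients can be read off from the five remaining functionals
  (\<open>V4_unisolvent\<close>).

  Why \<open>P\<^sub>4\<close> is unisolvent for the fifteen functionals. They contain the full Hermite data on the
  left edge and on the top edge, the two edges that avoid \<open>x\<^sub>2\<close>: along such an edge a quartic is
  determined by values and tangential derivatives at the ends and the value at the midpoint, and
  its normal derivative is a cubic determined by its values and derivatives at the ends. If
  these data vanish, then \<open>p\<close> vanishes to second order on both edges; in coordinates
  \<open>u\<close>, \<open>w\<close> with origin at \<open>x\<^sub>4\<close> this means that \<open>u\<^sup>2 w\<^sup>2\<close> divides \<open>p\<close>, so \<open>p\<close> is a multiple of
  \<open>u\<^sup>2 w\<^sup>2\<close>, which the value at the midpoint of the right edge kills. For existence, the data on
  the two edges agree at the common corner \<open>x\<^sub>4\<close>, so that the coefficients may be prescribed.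

  Because the basis functions are given by a definite description, the unisolvence of the Bell
  element is proved as well. Uniqueness (\<open>W4_eqI\<close>): the same edge argument, applied on all four
  edges, shows that the values and normal derivatives vanish there; on each of the three
  vertical lines through the nodes the function is then a quartic with vanishing Hermite data, and
  so it is zero on every horizontal line. Existence (\<open>bell_basis_exists\<close>): each basis function is a
  product of one-variable Hermite polynomials, corrected by the centre bubble for the mixed
  derivatives.

  All of this is carried out on coefficients of polynomials in the coordinates \<open>u\<close>, \<open>w\<close>.
\<close>

section \<open>Spans of functions\<close>

interpretation funs: vector_space "\<lambda>(c::real) (f::'a \<Rightarrow> real) z. c * f z"
  by unfold_locales (auto simp: fun_eq_iff algebra_simps)

lemma fun_span_finite:
  fixes f :: "'i \<Rightarrow> 'a \<Rightarrow> real"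
  assumes "finite I"
  shows "fun_span (f ` I) = {\<lambda>z. \<Sum>i\<in>I. a i * f i z | a. True}" (is "_ = ?R")
proof
  show "fun_span (f ` I) \<subseteq> ?R"
    unfolding fun_span_def
  proof (rule funs.span_minimal)
    show "f ` I \<subseteq> ?R"
    proof clarify
      fix i assume "i \<in> I"
      have "f i = (\<lambda>z. \<Sum>j\<in>I. (if j = i then 1 else 0) * f j z)"
        using \<open>i \<in> I\<close> assms by (auto simp: fun_eq_iff if_distrib[where f = "\<lambda>c. c * _"] cong: if_cong)
      then show "\<exists>a. f i = (\<lambda>z. \<Sum>j\<in>I. a j * f j z) \<and> True"
        by (intro exI[of _ "\<lambda>j. if j = i then 1 else 0"] conjI TrueI)
    qed
    show "funs.subspace ?R"
    proof (rule funs.subspaceI)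
      show "0 \<in> ?R" by (auto simp: fun_eq_iff intro!: exI[of _ "\<lambda>_. 0"])
    next
      fix u v assume "u \<in> ?R" "v \<in> ?R"
      then obtain a b where "u = (\<lambda>z. \<Sum>i\<in>I. a i * f i z)" "v = (\<lambda>z. \<Sum>i\<in>I. b i * f i z)" by blast
      then have "u + v = (\<lambda>z. \<Sum>i\<in>I. (a i + b i) * f i z)"
        by (simp add: fun_eq_iff distrib_right sum.distrib)
      then show "u + v \<in> ?R" by (auto intro!: exI[of _ "\<lambda>i. a i + b i"])
    next
      fix c u assume "u \<in> ?R"
      then obtain a where "u = (\<lambda>z. \<Sum>i\<in>I. a i * f i z)" by blast
      then have "(\<lambda>z. c * u z) = (\<lambda>z. \<Sum>i\<in>I. (c * a i) * f i z)"
        by (simp add: fun_eq_iff sum_distrib_left mult.assoc)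
      then show "(\<lambda>z. c * u z) \<in> ?R" by (auto intro!: exI[of _ "\<lambda>i. c * a i"])
    qed
  qed
  show "?R \<subseteq> fun_span (f ` I)"
  proof clarify
    fix a :: "'i \<Rightarrow> real"
    have "(\<Sum>i\<in>I. (\<lambda>z. a i * f i z)) \<in> fun_span (f ` I)"
      unfolding fun_span_def by (intro funs.span_sum funs.span_scale funs.span_base) auto
    moreover have "(\<Sum>i\<in>J. (\<lambda>z. a i * f i z)) = (\<lambda>z. \<Sum>i\<in>J. a i * f i z)" if "finite J" for J
      using that by (induction J) (auto simp: fun_eq_iff)
    ultimately show "(\<lambda>z. \<Sum>i\<in>I. a i * f i z) \<in> fun_span (f ` I)" using assms by simp
  qed
qed

definition monomials :: "'a set \<Rightarrow> ('a \<Rightarrow> real) \<Rightarrow> ('a \<Rightarrow> real) \<Rightarrow> (nat \<times> nat) set \<Rightarrow> ('a \<Rightarrow> real) set" where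
  "monomials T X Y A = (\<lambda>(i, j). on_set T (\<lambda>z. X z ^ i * Y z ^ j)) ` A"

lemma monomials_eq:
  "monomials T X Y A = {on_set T (\<lambda>z. X z ^ i * Y z ^ j) | i j. (i, j) \<in> A}"
  by (auto simp: monomials_def image_iff Bex_def)

text \<open>
  The span over an index set closed under decreasing the exponents contains every product of
  polynomials in the two coordinates of admissible degrees; this is what makes such spans
  independent of the choice of affine coordinates on each axis.
\<close>
lemma product_in_span_monomials:
  assumes "{..degree p} \<times> {..degree q} \<subseteq> A"
  shows "on_set T (\<lambda>z. poly p (X z) * poly q (Y z)) \<in> fun_span (monomials T X Y A)"
proof -
  let ?I = "{..degree p} \<times> {..degree q}"
  let ?a = "\<lambda>(i, j). coeff p i * coeff q j"
  have "on_set T (\<lambda>z. poly p (X z) * poly q (Y z)) =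
    (\<lambda>z. \<Sum>ij\<in>?I. ?a ij * (\<lambda>(i, j). on_set T (\<lambda>z. X z ^ i * Y z ^ j)) ij z)"
    by (auto simp: fun_eq_iff on_set_def poly_altdef sum_product sum.cartesian_product
        mult_ac case_prod_unfold intro!: sum.cong)
  also have "\<dots> \<in> fun_span (monomials T X Y ?I)"
    unfolding monomials_def by (subst fun_span_finite) blast+
  also have "\<dots> \<subseteq> fun_span (monomials T X Y A)"
    using assms unfolding fun_span_def monomials_def by (intro funs.span_mono image_mono)
  finally show ?thesis .
qed

lemma span_monomials_affine_subset:
  assumes down: "\<And>i j i' j'. (i, j) \<in> A \<Longrightarrow> i' \<le> i \<Longrightarrow> j' \<le> j \<Longrightarrow> (i', j') \<in> A"
    and X: "\<And>z. X z = \<beta> + \<alpha> * X' z" and Y: "\<And>z. Y z = \<delta> + \<gamma> * Y' z"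
  shows "fun_span (monomials T X Y A) \<subseteq> fun_span (monomials T X' Y' A)"
  unfolding fun_span_def
proof (rule funs.span_minimal)
  show "monomials T X Y A \<subseteq> funs.span (monomials T X' Y' A)"
  proof
    fix f assume "f \<in> monomials T X Y A"
    then obtain i j where ij: "(i, j) \<in> A" and f: "f = on_set T (\<lambda>z. X z ^ i * Y z ^ j)"
      by (auto simp: monomials_def)
    have deg: "degree ([:b, a:] ^ n) \<le> n" for a b :: real and n
      using degree_power_le[of "[:b, a:]" n] by (cases "a = 0") auto
    have "on_set T (\<lambda>z. poly ([:\<beta>, \<alpha>:] ^ i) (X' z) * poly ([:\<delta>, \<gamma>:] ^ j) (Y' z))
      \<in> fun_span (monomials T X' Y' A)"
      using down[OF ij] order_trans[OF _ deg] by (intro product_in_span_monomials) auto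
    then show "f \<in> funs.span (monomials T X' Y' A)"
      by (simp add: f fun_span_def X Y poly_power mult.commute)
  qed
qed (rule funs.subspace_span)

section \<open>Hermite interpolation\<close>

text \<open>
  The value (\<open>k = 0\<close>) or the first derivative (\<open>k = 1\<close>) at \<open>s\<close> of the \<open>i\<close>-th power, and below of the
  quartic with coefficients \<open>c\<close>. Writing both as one linear functional of the coefficients
  allows values and derivatives in two variables to be treated as tensor products.
\<close>
definition mono_jet :: "nat \<Rightarrow> real \<Rightarrow> nat \<Rightarrow> real" where
  "mono_jet k s i = (if k = 0 then s ^ i else real i * s ^ (i - 1))"

definition jet :: "(nat \<Rightarrow> real) \<Rightarrow> nat \<Rightarrow> real \<Rightarrow> real" where
  "jet c k s = (\<Sum>i\<le>4. c i * mono_jet k s i)"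

lemma sum_upto_4: "(\<Sum>i\<le>4. f i) = f 0 + f 1 + f 2 + f 3 + (f (4 :: nat) :: real)"
  by (simp add: eval_nat_numeral)

lemma all_upto_4: "(\<forall>i\<le>4. P i) \<longleftrightarrow> P 0 \<and> P 1 \<and> P 2 \<and> P 3 \<and> P (4 :: nat)"
  by (auto simp: eval_nat_numeral le_Suc_eq)

lemma quartic_eq_0:
  assumes "jet c 0 0 = 0" "jet c 0 (1/2) = 0" "jet c 0 1 = 0" "jet c 1 0 = 0" "jet c 1 1 = 0"
    and "i \<le> 4"
  shows "c i = 0"
proof -
  have e: "c 0 = 0" "c 1 = 0" "c 2 + c 3 + c 4 = 0" "2 * c 2 + 3 * c 3 + 4 * c 4 = 0"
    "4 * c 2 + 2 * c 3 + c 4 = 0"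
    using assms(1-5) by (simp_all add: jet_def mono_jet_def sum_upto_4 power_divide field_simps)
  then have "c 2 = 0" "c 3 = 0" "c 4 = 0" by linarith+
  with e have "\<forall>i\<le>4. c i = 0" unfolding all_upto_4 by blast
  with \<open>i \<le> 4\<close> show ?thesis by blast
qed

text \<open>
  Cubics are treated as quartics with vanishing top coefficient, the form in which the degree
  condition on normal derivatives appears.
\<close>
lemma cubic_eq_0:
  assumes "c 4 = 0" "jet c 0 0 = 0" "jet c 0 1 = 0" "jet c 1 0 = 0" "jet c 1 1 = 0"
    and "i \<le> 4"
  shows "c i = 0"
proof -
  have e: "c 0 = 0" "c 1 = 0" "c 2 + c 3 + c 4 = 0" "2 * c 2 + 3 * c 3 + 4 * c 4 = 0"
    using assms(2-5) by (simp_all add: jet_def mono_jet_def sum_upto_4 field_simps)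
  with assms(1) have "c 2 = 0" "c 3 = 0" by linarith+
  with e assms(1) have "\<forall>i\<le>4. c i = 0" unfolding all_upto_4 by blast
  with \<open>i \<le> 4\<close> show ?thesis by blast
qed

lemma cubic_interpolation:
  obtains c where "c 4 = 0" "jet c 0 0 = v0" "jet c 0 1 = v1" "jet c 1 0 = d0" "jet c 1 1 = d1"
proof
  let ?c = "\<lambda>i. [v0, d0, 3 * (v1 - v0) - 2 * d0 - d1, d0 + d1 - 2 * (v1 - v0), 0] ! i"
  show "?c 4 = 0" "jet ?c 0 0 = v0" "jet ?c 0 1 = v1" "jet ?c 1 0 = d0" "jet ?c 1 1 = d1"
    by (simp_all add: jet_def mono_jet_def sum_upto_4 eval_nat_numeral)
qed

lemma quartic_interpolation:
  obtains c where "jet c 0 0 = v0" "jet c 0 (1/2) = m" "jet c 0 1 = v1"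
    "jet c 1 0 = d0" "jet c 1 1 = d1"
proof -
  obtain b where b: "b 4 = 0" "jet b 0 0 = v0" "jet b 0 1 = v1" "jet b 1 0 = d0" "jet b 1 1 = d1"
    by (rule cubic_interpolation)
  let ?e = "16 * (m - jet b 0 (1/2))"
  \<comment> \<open>add a multiple of \<open>s\<^sup>2 (1 - s)\<^sup>2\<close>, which has value \<open>1/16\<close> at \<open>1/2\<close>\<close>
  let ?c = "\<lambda>i. b i + ?e * [0, 0, 1, - 2, 1] ! i"
  have "jet ?c k s = jet b k s + ?e * jet (\<lambda>i. [0, 0, 1, - 2, 1] ! i) k s" for k s
    by (simp add: jet_def distrib_right sum.distrib sum_distrib_left mult.assoc)
  moreover have
    "jet (\<lambda>i. [0, 0, 1, - 2, 1] ! i) 0 0 = 0" "jet (\<lambda>i. [0, 0, 1, - 2, 1] ! i) 0 1 = 0"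
    "jet (\<lambda>i. [0, 0, 1, - 2, 1] ! i) 1 0 = 0" "jet (\<lambda>i. [0, 0, 1, - 2, 1] ! i) 1 1 = 0"
    "jet (\<lambda>i. [0, 0, 1, - 2, 1] ! i) 0 (1/2) = 1/16"
    by (simp_all add: jet_def mono_jet_def sum_upto_4 eval_nat_numeral)
  ultimately show ?thesis using b by (intro that[of ?c]) (simp_all only:, simp_all add: field_simps)
qed

lemma jet_lincomb: "jet (\<lambda>i. c i + b * d i) k s = jet c k s + b * jet d k s"
  by (simp add: jet_def algebra_simps sum.distrib sum_distrib_left)

lemma jet_scale: "jet (\<lambda>i. b * c i) k s = b * jet c k s"
  by (simp add: jet_def mult.assoc sum_distrib_left)

lemma jet_scale_right: "jet (\<lambda>i. c i * b) k s = jet c k s * b"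
  by (simp add: jet_def mult_ac sum_distrib_left)

lemma jet_zero: "jet (\<lambda>i. 0) k s = 0"
  by (simp add: jet_def)

lemma jet_at_0: "jet c 0 0 = c 0" "jet c 1 0 = c 1"
  by (simp_all add: jet_def mono_jet_def sum_upto_4)

lemma jet_eq_0: "(\<And>i. i \<le> 4 \<Longrightarrow> c i = 0) \<Longrightarrow> jet c k s = 0"
  by (simp add: jet_def)

lemma has_real_derivative_jet: "(jet c 0 has_real_derivative jet c 1 s) (at s)"
  unfolding jet_def mono_jet_def by (auto intro!: derivative_eq_intros sum.cong)

definition jet2 :: "(nat \<Rightarrow> nat \<Rightarrow> real) \<Rightarrow> nat \<Rightarrow> nat \<Rightarrow> real \<Rightarrow> real \<Rightarrow> real" where
  "jet2 a k l s t = (\<Sum>i\<le>4. \<Sum>j\<le>4. a i j * mono_jet k s i * mono_jet l t j)"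

text \<open>
  Restricting to a line parallel to an axis turns a two-variable jet into a one-variable jet, so
  that the interpolation lemmas apply first along a line and then across the lines.
\<close>
lemma jet2_rows: "jet2 a k l s t = jet (\<lambda>i. jet (a i) l t) k s"
  by (simp add: jet2_def jet_def sum_distrib_right sum_distrib_left mult_ac)

lemma jet2_columns: "jet2 a k l s t = jet (\<lambda>j. jet (\<lambda>i. a i j) k s) l t"
  unfolding jet2_def jet_def
  by (subst sum.swap) (simp add: sum_distrib_right sum_distrib_left mult_ac)

lemma jet2_lincomb:
  "jet2 (\<lambda>i j. a i j + c * b i j) k l s t = jet2 a k l s t + c * jet2 b k l s t"
  by (simp add: jet2_def algebra_simps sum.distrib sum_distrib_left)

lemma jet2_product: "jet2 (\<lambda>i j. p i * q j) k l s t = jet p k s * jet q l t"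
  by (simp add: jet2_def jet_def sum_product mult_ac)

section \<open>Polynomials on the square in reduced coordinates\<close>

text \<open>
  Coordinates that map the square to the unit square. The second one runs downwards from the top
  edge, so that the origin is the upper left vertex: there the two edges meet along which the
  fifteen functionals give full Hermite data, and on these edges traces and normal derivatives
  are single rows or columns of coefficients.
\<close>
definition redx :: "real \<times> real \<Rightarrow> real \<Rightarrow> real \<times> real \<Rightarrow> real" where
  "redx x1 h z = (fst z - fst x1) / h"

definition redy :: "real \<times> real \<Rightarrow> real \<Rightarrow> real \<times> real \<Rightarrow> real" where
  "redy x1 h z = 1 - (snd z - snd x1) / h"

definition sqpoly :: "real \<times> real \<Rightarrow> real \<Rightarrow> (nat \<Rightarrow> nat \<Rightarrow> real) \<Rightarrow> real \<times> real \<Rightarrow> real" where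
  "sqpoly x1 h a = on_set (square x1 h) (\<lambda>z. jet2 a 0 0 (redx x1 h z) (redy x1 h z))"

lemma sqpoly_lincomb:
  "sqpoly x1 h (\<lambda>i j. a i j + c * b i j) = (\<lambda>z. sqpoly x1 h a z + c * sqpoly x1 h b z)"
  by (simp add: fun_eq_iff sqpoly_def on_set_def jet2_lincomb)

lemma sqpoly_cong:
  assumes "\<And>i j. i \<le> 4 \<Longrightarrow> j \<le> 4 \<Longrightarrow> a i j = b i j"
  shows "sqpoly x1 h a = sqpoly x1 h b"
  using assms by (simp add: sqpoly_def on_set_def jet2_def fun_eq_iff)

lemma span_monomials_reduced:
  assumes "h > 0" and "\<And>i j i' j'. (i, j) \<in> A \<Longrightarrow> i' \<le> i \<Longrightarrow> j' \<le> j \<Longrightarrow> (i', j') \<in> A"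
  shows "fun_span (monomials T fst snd A) = fun_span (monomials T (redx x1 h) (redy x1 h) A)"
proof
  have X: "fst z = fst x1 + h * redx x1 h z" and Y: "snd z = (snd x1 + h) + (- h) * redy x1 h z" for z
    using assms(1) by (simp_all add: redx_def redy_def field_simps)
  show "fun_span (monomials T fst snd A) \<subseteq> fun_span (monomials T (redx x1 h) (redy x1 h) A)"
    by (rule span_monomials_affine_subset[OF _ X Y]) (rule assms(2))
  have X': "redx x1 h z = - (fst x1 / h) + 1 / h * fst z"
    and Y': "redy x1 h z = (1 + snd x1 / h) + (- 1 / h) * snd z" for z
    by (simp_all add: redx_def redy_def diff_divide_distrib)
  show "fun_span (monomials T (redx x1 h) (redy x1 h) A) \<subseteq> fun_span (monomials T fst snd A)"
    by (rule span_monomials_affine_subset[OF _ X' Y']) (rule assms(2))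
qed

lemma span_monomials_sqpoly:
  assumes "A \<subseteq> {..4} \<times> {..4}"
  shows "fun_span (monomials (square x1 h) (redx x1 h) (redy x1 h) A) =
    sqpoly x1 h ` {a. \<forall>i\<le>4. \<forall>j\<le>4. (i, j) \<notin> A \<longrightarrow> a i j = 0}"
proof -
  let ?T = "square x1 h" and ?X = "redx x1 h" and ?Y = "redy x1 h"
  have fin: "finite A" using assms finite_subset by blast
  have eq: "(\<lambda>z. \<Sum>ij\<in>A. a ij * (case ij of (i, j) \<Rightarrow> on_set ?T (\<lambda>z. ?X z ^ i * ?Y z ^ j)) z) =
      sqpoly x1 h b"
    if "\<And>i j. (i, j) \<in> A \<Longrightarrow> b i j = a (i, j)"
      "\<And>i j. i \<le> 4 \<Longrightarrow> j \<le> 4 \<Longrightarrow> (i, j) \<notin> A \<Longrightarrow> b i j = 0" for a b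
  proof
    fix z
    have "sqpoly x1 h b z =
        (\<Sum>(i, j)\<in>{..4} \<times> {..4}. b i j * on_set ?T (\<lambda>z. ?X z ^ i * ?Y z ^ j) z)"
      by (simp add: sqpoly_def on_set_def jet2_def mono_jet_def sum.cartesian_product mult.assoc)
    also have "\<dots> = (\<Sum>(i, j)\<in>A. b i j * on_set ?T (\<lambda>z. ?X z ^ i * ?Y z ^ j) z)"
      using assms that(2) by (intro sum.mono_neutral_right) auto
    finally show "(\<Sum>ij\<in>A. a ij * (case ij of (i, j) \<Rightarrow> on_set ?T (\<lambda>z. ?X z ^ i * ?Y z ^ j)) z) =
        sqpoly x1 h b z"
      using that(1) by (auto intro!: sum.cong)
  qed
  show ?thesis
    unfolding monomials_def fun_span_finite[OF fin]
  proof (intro equalityI subsetI)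
    fix f assume "f \<in> {\<lambda>z. \<Sum>ij\<in>A. a ij * (case ij of (i, j) \<Rightarrow> on_set ?T (\<lambda>z. ?X z ^ i * ?Y z ^ j)) z | a. True}"
    then obtain a where "f = (\<lambda>z. \<Sum>ij\<in>A. a ij * (case ij of (i, j) \<Rightarrow> on_set ?T (\<lambda>z. ?X z ^ i * ?Y z ^ j)) z)"
      by blast
    also have "\<dots> = sqpoly x1 h (\<lambda>i j. if (i, j) \<in> A then a (i, j) else 0)"
      by (rule eq) auto
    finally show "f \<in> sqpoly x1 h ` {a. \<forall>i\<le>4. \<forall>j\<le>4. (i, j) \<notin> A \<longrightarrow> a i j = 0}" by auto
  next
    fix f assume "f \<in> sqpoly x1 h ` {a. \<forall>i\<le>4. \<forall>j\<le>4. (i, j) \<notin> A \<longrightarrow> a i j = 0}"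
    then obtain b where b: "\<forall>i\<le>4. \<forall>j\<le>4. (i, j) \<notin> A \<longrightarrow> b i j = 0" and f: "f = sqpoly x1 h b" by blast
    have "f = (\<lambda>z. \<Sum>ij\<in>A. (case ij of (i, j) \<Rightarrow> b i j) *
        (case ij of (i, j) \<Rightarrow> on_set ?T (\<lambda>z. ?X z ^ i * ?Y z ^ j)) z)"
      unfolding f by (rule eq[symmetric]) (use b in auto)
    then show "f \<in> {\<lambda>z. \<Sum>ij\<in>A. a ij * (case ij of (i, j) \<Rightarrow> on_set ?T (\<lambda>z. ?X z ^ i * ?Y z ^ j)) z | a. True}"
      by blast
  qed
qed

lemma Q_space_4:
  assumes "h > 0"
  shows "Q_space 4 (square x1 h) = range (sqpoly x1 h)"
proof -
  let ?A = "{..4} \<times> {..4} :: (nat \<times> nat) set"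
  have "Q_space 4 (square x1 h) = fun_span (monomials (square x1 h) fst snd ?A)"
    unfolding Q_space_def monomials_eq monomial2_def
    by (simp add: case_prod_unfold)
  also have "\<dots> = fun_span (monomials (square x1 h) (redx x1 h) (redy x1 h) ?A)"
    using assms by (rule span_monomials_reduced) auto
  also have "\<dots> = range (sqpoly x1 h)"
    by (simp add: span_monomials_sqpoly)
  finally show ?thesis .
qed

lemma P_space_4:
  assumes "h > 0"
  shows "P_space 4 (square x1 h) = sqpoly x1 h ` {a. \<forall>i\<le>4. \<forall>j\<le>4. 4 < i + j \<longrightarrow> a i j = 0}"
proof -
  let ?A = "{(i, j). i + j \<le> 4} :: (nat \<times> nat) set"
  have "P_space 4 (square x1 h) = fun_span (monomials (square x1 h) fst snd ?A)"
    unfolding P_space_def monomials_eq monomial2_def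
    by (simp add: case_prod_unfold)
  also have "\<dots> = fun_span (monomials (square x1 h) (redx x1 h) (redy x1 h) ?A)"
    using assms by (rule span_monomials_reduced) auto
  also have "\<dots> = sqpoly x1 h ` {a. \<forall>i\<le>4. \<forall>j\<le>4. (i, j) \<notin> ?A \<longrightarrow> a i j = 0}"
    by (rule span_monomials_sqpoly) auto
  finally show ?thesis by (simp add: not_le)
qed

section \<open>Derivatives on the square\<close>

lemma mem_square:
  "z \<in> square x1 h \<longleftrightarrow>
    fst x1 \<le> fst z \<and> fst z \<le> fst x1 + h \<and> snd x1 \<le> snd z \<and> snd z \<le> snd x1 + h"
  by (cases x1; cases z) (auto simp: square_def cbox_Pair_eq)

text \<open>
  The set of admissible parameters is an interval containing \<open>0\<close> and at least one of
  \<open>h / 2\<close>, \<open>- h / 2\<close>, so the possibly one-sided derivative is unique and agrees with the two-sided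
  derivative of any smooth extension of \<open>f\<close>.
\<close>
lemma dir_deriv_square:
  assumes "h > 0" and z: "z \<in> square x1 h" and d: "d \<in> {(1, 0), (- 1, 0), (0, 1), (0, - 1)}"
    and eq: "\<And>y. y \<in> square x1 h \<Longrightarrow> f y = g y"
    and der: "((\<lambda>t. g (z + t *\<^sub>R d)) has_real_derivative D) (at 0)"
  shows "dir_deriv (square x1 h) d f z = D"
proof -
  let ?S = "{t. z + t *\<^sub>R d \<in> square x1 h}"
  have 0: "0 \<in> ?S" using z by simp
  have "convex ?S"
  proof (rule convexI, clarify)
    fix s t u v :: real
    assume *: "z + s *\<^sub>R d \<in> square x1 h" "z + t *\<^sub>R d \<in> square x1 h" "0 \<le> u" "0 \<le> v" "u + v = 1"
    have "u *\<^sub>R (z + s *\<^sub>R d) + v *\<^sub>R (z + t *\<^sub>R d) \<in> square x1 h"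
      using * unfolding square_def by (intro convexD[OF convex_box(1)])
    also have "u *\<^sub>R (z + s *\<^sub>R d) + v *\<^sub>R (z + t *\<^sub>R d) = (u + v) *\<^sub>R z + (u * s + v * t) *\<^sub>R d"
      by (simp add: algebra_simps)
    finally show "z + (u *\<^sub>R s + v *\<^sub>R t) *\<^sub>R d \<in> square x1 h" using * by simp
  qed
  moreover have "h / 2 \<in> ?S \<or> - h / 2 \<in> ?S"
    using d z \<open>h > 0\<close> by (auto simp: mem_square)
  then obtain t where "t \<in> ?S" "t \<noteq> 0" using \<open>h > 0\<close> by fastforce
  then have "?S \<noteq> {y}" for y using 0 by (metis singletonD)
  ultimately have "0 islimpt ?S"
    by (intro connected_imp_perfect convex_connected 0)
  then have "at 0 within ?S \<noteq> bot" by (simp add: trivial_limit_within)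
  moreover have "((\<lambda>t. f (z + t *\<^sub>R d)) has_vector_derivative D) (at 0 within ?S)"
  proof (rule has_vector_derivative_transform[OF 0])
    show "((\<lambda>t. g (z + t *\<^sub>R d)) has_vector_derivative D) (at 0 within ?S)"
      using der by (simp add: has_real_derivative_iff_has_vector_derivative has_vector_derivative_at_within)
  qed (use eq in auto)
  ultimately show ?thesis
    unfolding dir_deriv_def by (rule vector_derivative_within)
qed

text \<open>
  Only agreement on the square is assumed, so that the rule for \<open>y\<close> below applies to the function
  \<open>dx T v\<close>, whose values outside the square are of no particular form.
\<close>
lemma dir_deriv_x:
  assumes "h > 0" and "z \<in> square x1 h" and "\<sigma> \<in> {1, - 1}"
    and "\<And>y. y \<in> square x1 h \<Longrightarrow> f y = c * jet2 a 0 l (redx x1 h y) (redy x1 h y)"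
  shows "dir_deriv (square x1 h) (\<sigma>, 0) f z =
    \<sigma> / h * c * jet2 a 1 l (redx x1 h z) (redy x1 h z)"
proof (rule dir_deriv_square[OF assms(1,2) _ assms(4)])
  let ?c = "\<lambda>i. jet (a i) l (redy x1 h z)"
  have "((\<lambda>t. redx x1 h z + t * \<sigma> / h) has_real_derivative \<sigma> / h) (at 0)"
    using assms(1) by (auto intro!: derivative_eq_intros)
  from DERIV_chain2[OF has_real_derivative_jet this, of ?c]
  show "((\<lambda>t. c * jet2 a 0 l (redx x1 h (z + t *\<^sub>R (\<sigma>, 0))) (redy x1 h (z + t *\<^sub>R (\<sigma>, 0))))
      has_real_derivative \<sigma> / h * c * jet2 a 1 l (redx x1 h z) (redy x1 h z)) (at 0)"
    by (auto simp: jet2_rows redx_def redy_def add_divide_distrib diff_divide_distrib algebra_simps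
        intro!: derivative_eq_intros)
qed (use assms(3) in auto)

lemma dir_deriv_y:
  assumes "h > 0" and "z \<in> square x1 h" and "\<sigma> \<in> {1, - 1}"
    and "\<And>y. y \<in> square x1 h \<Longrightarrow> f y = c * jet2 a k 0 (redx x1 h y) (redy x1 h y)"
  shows "dir_deriv (square x1 h) (0, \<sigma>) f z =
    - \<sigma> / h * c * jet2 a k 1 (redx x1 h z) (redy x1 h z)"
proof (rule dir_deriv_square[OF assms(1,2) _ assms(4)])
  let ?c = "\<lambda>j. jet (\<lambda>i. a i j) k (redx x1 h z)"
  have "((\<lambda>t. redy x1 h z - t * \<sigma> / h) has_real_derivative - \<sigma> / h) (at 0)"
    using assms(1) by (auto intro!: derivative_eq_intros)
  from DERIV_chain2[OF has_real_derivative_jet this, of ?c]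
  show "((\<lambda>t. c * jet2 a k 0 (redx x1 h (z + t *\<^sub>R (0, \<sigma>))) (redy x1 h (z + t *\<^sub>R (0, \<sigma>))))
      has_real_derivative - \<sigma> / h * c * jet2 a k 1 (redx x1 h z) (redy x1 h z)) (at 0)"
    by (auto simp: jet2_columns redx_def redy_def add_divide_distrib diff_divide_distrib algebra_simps
        intro!: derivative_eq_intros)
qed (use assms(3) in auto)

lemma sqpoly_on_square:
  "z \<in> square x1 h \<Longrightarrow> sqpoly x1 h a z = 1 * jet2 a 0 0 (redx x1 h z) (redy x1 h z)"
  by (simp add: sqpoly_def on_set_def)

lemma dx_sqpoly:
  assumes "h > 0" "z \<in> square x1 h"
  shows "dx (square x1 h) (sqpoly x1 h a) z = 1 / h * jet2 a 1 0 (redx x1 h z) (redy x1 h z)"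
  unfolding dx_def using dir_deriv_x[OF assms _ sqpoly_on_square, of 1] by simp

lemma dy_sqpoly:
  assumes "h > 0" "z \<in> square x1 h"
  shows "dy (square x1 h) (sqpoly x1 h a) z = - 1 / h * jet2 a 0 1 (redx x1 h z) (redy x1 h z)"
  unfolding dy_def using dir_deriv_y[OF assms _ sqpoly_on_square, of 1] by simp

lemma dxy_sqpoly:
  assumes "h > 0" "z \<in> square x1 h"
  shows "dxy (square x1 h) (sqpoly x1 h a) z = - 1 / h^2 * jet2 a 1 1 (redx x1 h z) (redy x1 h z)"
  unfolding dxy_def dy_def using dir_deriv_y[OF assms _ dx_sqpoly, of 1] assms
  by (simp add: power2_eq_square)

lemma bell_dof_sqpoly:
  assumes "h > 0" "(l, i, j) \<in> bell_index"
  shows "bell_dof x1 h l i j (sqpoly x1 h a) =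
    (if l = 1 then jet2 a 0 0 (real i / 2) (1 - real j / 2)
     else if l = 2 then 1 / h * jet2 a 1 0 (real i) (1 - real j)
     else if l = 3 then - 1 / h * jet2 a 0 1 (real i) (1 - real j)
     else - 1 / h^2 * jet2 a 1 1 (real i) (1 - real j))"
proof -
  let ?z = "x1 + (if l = 1 then h / 2 else h) *\<^sub>R (real i, real j)"
  have "?z \<in> square x1 h"
    using assms by (auto simp: bell_index_def mem_square)
  moreover have "redx x1 h ?z = (if l = 1 then real i / 2 else real i)"
    "redy x1 h ?z = (if l = 1 then 1 - real j / 2 else 1 - real j)"
    using assms(1) by (auto simp: redx_def redy_def)
  ultimately show ?thesis
    using assms(1)
    by (simp add: bell_dof_def sqpoly_on_square dx_sqpoly dy_sqpoly dxy_sqpoly del: eq_divide_eq_numeral1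
        split: if_splits)
qed

abbreviation bdof :: "real \<times> real \<Rightarrow> real \<Rightarrow> nat \<times> nat \<times> nat \<Rightarrow> (real \<times> real \<Rightarrow> real) \<Rightarrow> real" where
  "bdof x1 h \<equiv> \<lambda>(l, i, j). bell_dof x1 h l i j"

text \<open>
  Clearing the powers of \<open>h\<close> leaves conditions on jets at the nodes \<open>0\<close>, \<open>1/2\<close>, \<open>1\<close>; since the second
  coordinate runs downwards, index \<open>j\<close> belongs to the node \<open>1 - j / 2\<close> or \<open>1 - j\<close>.
\<close>
lemma bdofs_sqpoly:
  assumes "h > 0"
  shows "(\<forall>r \<in> bell_index. bdof x1 h r (sqpoly x1 h a) = D r) \<longleftrightarrow>
    (\<forall>i\<in>{0, 1, 2}. \<forall>j\<in>{0, 1, 2}. jet2 a 0 0 (real i / 2) (1 - real j / 2) = D (1, i, j)) \<and>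
    (\<forall>i\<in>{0, 1}. \<forall>j\<in>{0, 1}. jet2 a 1 0 (real i) (1 - real j) = h * D (2, i, j) \<and>
      jet2 a 0 1 (real i) (1 - real j) = - h * D (3, i, j) \<and>
      jet2 a 1 1 (real i) (1 - real j) = - (h^2) * D (4, i, j))"
proof -
  have split: "(\<forall>r \<in> bell_index. P r) \<longleftrightarrow> (\<forall>i\<in>{0, 1, 2}. \<forall>j\<in>{0, 1, 2}. P (1, i, j)) \<and>
      (\<forall>i\<in>{0, 1}. \<forall>j\<in>{0, 1}. P (2, i, j) \<and> P (3, i, j) \<and> P (4, i, j))" for P
    by (auto simp: bell_index_def)
  have dofs: "bell_dof x1 h 1 i j (sqpoly x1 h a) = D (1, i, j) \<longleftrightarrow>
      jet2 a 0 0 (real i / 2) (1 - real j / 2) = D (1, i, j)"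
    if "i \<in> {0, 1, 2}" "j \<in> {0, 1, 2}" for i j
    using that assms by (subst bell_dof_sqpoly) (auto simp: bell_index_def)
  have dofs': "bell_dof x1 h 2 i j (sqpoly x1 h a) = D (2, i, j) \<longleftrightarrow>
        jet2 a 1 0 (real i) (1 - real j) = h * D (2, i, j)"
      "bell_dof x1 h 3 i j (sqpoly x1 h a) = D (3, i, j) \<longleftrightarrow>
        jet2 a 0 1 (real i) (1 - real j) = - h * D (3, i, j)"
      "bell_dof x1 h 4 i j (sqpoly x1 h a) = D (4, i, j) \<longleftrightarrow>
        jet2 a 1 1 (real i) (1 - real j) = - (h^2) * D (4, i, j)"
    if "i \<in> {0, 1}" "j \<in> {0, 1}" for i j
  proof -
    have "(2, i, j) \<in> bell_index" "(3, i, j) \<in> bell_index" "(4, i, j) \<in> bell_index"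
      using that by (auto simp: bell_index_def)
    then show "bell_dof x1 h 2 i j (sqpoly x1 h a) = D (2, i, j) \<longleftrightarrow>
        jet2 a 1 0 (real i) (1 - real j) = h * D (2, i, j)"
      "bell_dof x1 h 3 i j (sqpoly x1 h a) = D (3, i, j) \<longleftrightarrow>
        jet2 a 0 1 (real i) (1 - real j) = - h * D (3, i, j)"
      "bell_dof x1 h 4 i j (sqpoly x1 h a) = D (4, i, j) \<longleftrightarrow>
        jet2 a 1 1 (real i) (1 - real j) = - (h^2) * D (4, i, j)"
      using assms by (auto simp: bell_dof_sqpoly field_simps)
  qed
  show ?thesis
    unfolding split prod.case
    by (intro arg_cong2[where f = "(\<and>)"] ball_cong refl dofs dofs')
qed

lemma bdof_lincomb:
  assumes "h > 0" "r \<in> bell_index" "f \<in> range (sqpoly x1 h)" "g \<in> range (sqpoly x1 h)"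
  shows "bdof x1 h r (\<lambda>z. f z + c * g z) = bdof x1 h r f + c * bdof x1 h r g"
proof -
  obtain a b where [simp]: "f = sqpoly x1 h a" "g = sqpoly x1 h b" using assms by blast
  show ?thesis
    using assms(1,2)
    by (cases r) (auto simp: sqpoly_lincomb[symmetric] bell_dof_sqpoly jet2_lincomb field_simps)
qed

lemma bdof_sum:
  assumes "h > 0" "r \<in> bell_index" "f \<in> range (sqpoly x1 h)"
    and "finite N" "\<And>s. s \<in> N \<Longrightarrow> g s \<in> range (sqpoly x1 h)"
  shows "bdof x1 h r (\<lambda>z. f z + (\<Sum>s\<in>N. c s * g s z)) =
      bdof x1 h r f + (\<Sum>s\<in>N. c s * bdof x1 h r (g s)) \<and>
    (\<lambda>z. f z + (\<Sum>s\<in>N. c s * g s z)) \<in> range (sqpoly x1 h)"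
  using assms(4,5)
proof (induction N)
  case empty
  then show ?case using assms(3) by simp
next
  case (insert s N)
  let ?F = "\<lambda>z. f z + (\<Sum>s\<in>N. c s * g s z)"
  have eq: "(\<lambda>z. f z + (\<Sum>s\<in>insert s N. c s * g s z)) = (\<lambda>z. ?F z + c s * g s z)"
    using insert.hyps by (simp add: fun_eq_iff)
  have F: "?F \<in> range (sqpoly x1 h)" and g: "g s \<in> range (sqpoly x1 h)"
    using insert by auto
  then obtain a b where "?F = sqpoly x1 h a" "g s = sqpoly x1 h b" by blast
  then have "(\<lambda>z. ?F z + c s * g s z) = sqpoly x1 h (\<lambda>i j. a i j + c s * b i j)"
    by (simp add: sqpoly_lincomb fun_eq_iff)
  then show ?case
    unfolding eq bdof_lincomb[OF assms(1,2) F g] using insert by simp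
qed

section \<open>Unisolvence of the Bell element\<close>

lemma poly_on_edge_jet:
  assumes "\<kappa> \<noteq> 0" and g: "\<And>t. t \<in> {0..1} \<Longrightarrow> g (A + t *\<^sub>R (B - A)) = \<kappa> * jet c 0 t"
  shows "poly_on_edge 3 A B g \<longleftrightarrow> c 4 = 0"
proof -
  let ?r = "smult \<kappa> [:c 0, c 1, c 2, c 3, c 4:]"
  have r: "poly ?r t = \<kappa> * jet c 0 t" for t
    by (simp add: jet_def mono_jet_def sum_upto_4 eval_nat_numeral algebra_simps)
  have "c 4 = 0" if "degree q \<le> 3" and q: "\<forall>t\<in>{0..1}. g (A + t *\<^sub>R (B - A)) = poly q t" for q
  proof -
    have "poly (?r - q) t = 0" if "t \<in> {0..1}" for t
      using q g[OF that] that unfolding poly_diff r by simp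
    then have "{0..1} \<subseteq> {t. poly (?r - q) t = 0}" by blast
    then have "infinite {t. poly (?r - q) t = 0}"
      by (rule infinite_super) (simp add: infinite_Icc)
    then have "?r - q = 0" using poly_roots_finite by blast
    then have "coeff ?r 4 = coeff q 4" by simp
    also have "\<dots> = 0" using \<open>degree q \<le> 3\<close> by (intro coeff_eq_0) simp
    finally show "c 4 = 0" using \<open>\<kappa> \<noteq> 0\<close> by (simp add: eval_nat_numeral)
  qed
  moreover have "poly_on_edge 3 A B g" if "c 4 = 0"
    unfolding poly_on_edge_def using that g r by (intro exI[of _ ?r]) (auto simp: eval_nat_numeral)
  ultimately show ?thesis unfolding poly_on_edge_def by blast
qed

lemma poly_on_edge_reverse: "poly_on_edge k A B g \<longleftrightarrow> poly_on_edge k B A g"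
proof -
  have "poly_on_edge k B A g" if AB: "poly_on_edge k A B g" for A B
  proof -
    obtain q where q: "degree q \<le> k" "\<forall>t\<in>{0..1}. g (A + t *\<^sub>R (B - A)) = poly q t"
      using AB unfolding poly_on_edge_def by blast
    have "B + t *\<^sub>R (A - B) = A + (1 - t) *\<^sub>R (B - A)" for t
      by (simp add: algebra_simps)
    then have "\<forall>t\<in>{0..1}. g (B + t *\<^sub>R (A - B)) = poly (pcompose q [:1, -1:]) t"
      using q(2) by (simp add: poly_pcompose)
    then show ?thesis
      unfolding poly_on_edge_def using q(1) by (intro exI[of _ "pcompose q [:1, -1:]"]) (auto simp: degree_pcompose)
  qed
  then show ?thesis by blast
qed

text \<open>
  On every edge the normal derivative is a quartic in the edge parameter, and the Bell condition
  says that its top coefficient is zero. These coefficients are again one-variable jets, of the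
  top row and the top column of \<open>a\<close>.
\<close>
lemma sqpoly_in_W4_iff:
  assumes "h > 0"
  shows "sqpoly x1 h a \<in> W4 x1 h \<longleftrightarrow>
    jet (\<lambda>i. a i 4) 1 0 = 0 \<and> jet (\<lambda>i. a i 4) 1 1 = 0 \<and> jet (a 4) 1 0 = 0 \<and> jet (a 4) 1 1 = 0"
proof -
  let ?D = "\<lambda>n. dir_deriv (square x1 h) n (sqpoly x1 h a)"
  note dx = dir_deriv_x[OF assms _ _ sqpoly_on_square]
  note dy = dir_deriv_y[OF assms _ _ sqpoly_on_square]
  have bottom: "poly_on_edge 3 x1 (x1 + h *\<^sub>R (1, 0)) (?D (0, - 1)) \<longleftrightarrow> jet (a 4) 1 1 = 0"
  proof (rule poly_on_edge_jet)
    fix t :: real assume "t \<in> {0..1}"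
    then show "?D (0, - 1) (x1 + t *\<^sub>R (x1 + h *\<^sub>R (1, 0) - x1)) = 1 / h * jet (\<lambda>i. jet (a i) 1 1) 0 t"
      using assms by (subst dy) (auto simp: mem_square redx_def redy_def jet2_rows mult_left_le_one_le)
  qed (use assms in auto)
  have top: "poly_on_edge 3 (x1 + h *\<^sub>R (0, 1)) (x1 + h *\<^sub>R (1, 1)) (?D (0, 1)) \<longleftrightarrow> jet (a 4) 1 0 = 0"
  proof (rule poly_on_edge_jet)
    fix t :: real assume "t \<in> {0..1}"
    then show "?D (0, 1) (x1 + h *\<^sub>R (0, 1) + t *\<^sub>R (x1 + h *\<^sub>R (1, 1) - (x1 + h *\<^sub>R (0, 1)))) =
        - 1 / h * jet (\<lambda>i. jet (a i) 1 0) 0 t"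
      using assms by (subst dy) (auto simp: mem_square redx_def redy_def jet2_rows mult_left_le_one_le)
  qed (use assms in auto)
  \<comment> \<open>The vertical edges are run through downwards, along which \<open>redy\<close> increases.\<close>
  have right: "poly_on_edge 3 (x1 + h *\<^sub>R (1, 1)) (x1 + h *\<^sub>R (1, 0)) (?D (1, 0)) \<longleftrightarrow>
      jet (\<lambda>i. a i 4) 1 1 = 0"
  proof (rule poly_on_edge_jet)
    fix t :: real assume "t \<in> {0..1}"
    then show "?D (1, 0) (x1 + h *\<^sub>R (1, 1) + t *\<^sub>R (x1 + h *\<^sub>R (1, 0) - (x1 + h *\<^sub>R (1, 1)))) =
        1 / h * jet (\<lambda>j. jet (\<lambda>i. a i j) 1 1) 0 t"
      using assms
      by (subst dx) (auto simp: mem_square redx_def redy_def jet2_columns mult_left_le_one_le diff_divide_distrib)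
  qed (use assms in auto)
  have left: "poly_on_edge 3 (x1 + h *\<^sub>R (0, 1)) x1 (?D (- 1, 0)) \<longleftrightarrow> jet (\<lambda>i. a i 4) 1 0 = 0"
  proof (rule poly_on_edge_jet)
    fix t :: real assume "t \<in> {0..1}"
    then show "?D (- 1, 0) (x1 + h *\<^sub>R (0, 1) + t *\<^sub>R (x1 - (x1 + h *\<^sub>R (0, 1)))) =
        - 1 / h * jet (\<lambda>j. jet (\<lambda>i. a i j) 1 0) 0 t"
      using assms
      by (subst dx) (auto simp: mem_square redx_def redy_def jet2_columns mult_left_le_one_le diff_divide_distrib)
  qed (use assms in auto)
  show ?thesis
    unfolding W4_def square_edges_def mem_Collect_eq Q_space_4[OF assms] ball_simps prod.case
    using bottom top right[unfolded poly_on_edge_reverse[of _ "x1 + h *\<^sub>R (1, 1)"]]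
      left[unfolded poly_on_edge_reverse[of _ "x1 + h *\<^sub>R (0, 1)"]]
    by blast
qed

text \<open>
  Uniqueness for the Bell element. The degree condition makes the normal derivatives on the
  edges cubics, so that end point data determine them; this replaces the four values of normal
  derivatives at edge midpoints that unisolvence on all of \<open>Q\<^sub>4\<close> would need.
\<close>
lemma W4_eq_0:
  assumes "jet (\<lambda>i. a i 4) 1 0 = 0" "jet (\<lambda>i. a i 4) 1 1 = 0" "jet (a 4) 1 0 = 0" "jet (a 4) 1 1 = 0"
    and val: "\<And>s t. s \<in> {0, 1/2, 1} \<Longrightarrow> t \<in> {0, 1/2, 1} \<Longrightarrow> jet2 a 0 0 s t = 0"
    and der: "\<And>k l s t. k \<in> {0, 1} \<Longrightarrow> l \<in> {0, 1} \<Longrightarrow> k + l > 0 \<Longrightarrow> s \<in> {0, 1} \<Longrightarrow> t \<in> {0, 1} \<Longrightarrow>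
      jet2 a k l s t = 0"
    and "i \<le> 4" "j \<le> 4"
  shows "a i j = 0"
proof -
  have edge_x: "jet (\<lambda>i. a i j) 0 s = 0" if "s \<in> {0, 1}" "j \<le> 4" for s j
    by (rule quartic_eq_0[OF _ _ _ _ _ \<open>j \<le> 4\<close>]; unfold jet2_columns[symmetric]) (use val der that in auto)
  have normal_y: "jet (a i) 1 t = 0" if "t \<in> {0, 1}" "i \<le> 4" for t i
    by (rule cubic_eq_0[OF _ _ _ _ _ \<open>i \<le> 4\<close>]; (unfold jet2_rows[symmetric])?) (use assms(3,4) der that in auto)
  have normal_x: "jet (\<lambda>i. a i j) 1 s = 0" if "s \<in> {0, 1}" "j \<le> 4" for s j
    by (rule cubic_eq_0[OF _ _ _ _ _ \<open>j \<le> 4\<close>]; (unfold jet2_columns[symmetric])?) (use assms(1,2) der that in auto)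
  \<comment> \<open>The values on the vertical middle line are known only at three nodes; the two missing
    end point derivatives are normal derivatives on the horizontal edges.\<close>
  have "jet2 a 0 1 (1/2) t = 0" if "t \<in> {0, 1}" for t
    unfolding jet2_rows using normal_y that by (intro jet_eq_0[of "\<lambda>i. jet (a i) 1 t"]) auto
  then have middle: "jet (\<lambda>i. a i j) 0 (1/2) = 0" if "j \<le> 4" for j
    by - (rule quartic_eq_0[OF _ _ _ _ _ \<open>j \<le> 4\<close>]; unfold jet2_columns[symmetric]; use val in auto)
  show "a i j = 0"
    by (rule quartic_eq_0[of "\<lambda>i. a i j"]) (use edge_x normal_x middle assms(7,8) in simp_all)
qed

lemma W4_eqI:
  assumes "h > 0" "v \<in> W4 x1 h" "w \<in> W4 x1 h"
    and eq: "\<And>r. r \<in> bell_index \<Longrightarrow> bdof x1 h r v = bdof x1 h r w"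
  shows "v = w"
proof -
  have "v \<in> range (sqpoly x1 h)" "w \<in> range (sqpoly x1 h)"
    using assms(1-3) by (auto simp: W4_def Q_space_4)
  then obtain a b where v: "v = sqpoly x1 h a" and w: "w = sqpoly x1 h b" by blast
  define c where "c = (\<lambda>i j. a i j + (- 1) * b i j)"
  have top: "jet (\<lambda>i. c i 4) k s = jet (\<lambda>i. a i 4) k s - jet (\<lambda>i. b i 4) k s"
    "jet (c 4) k s = jet (a 4) k s - jet (b 4) k s" for k s
    unfolding c_def jet_lincomb by simp_all
  have jet2: "jet2 c k l s t = jet2 a k l s t - jet2 b k l s t" for k l s t
    unfolding c_def jet2_lincomb by simp
  have "c i j = 0" if "i \<le> 4" "j \<le> 4" for i j
  proof (rule W4_eq_0[OF _ _ _ _ _ _ that])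
    fix s t :: real assume "s \<in> {0, 1/2, 1}" "t \<in> {0, 1/2, 1}"
    then obtain i j where ij: "s = real i / 2" "t = 1 - real j / 2" "i \<in> {0, 1, 2}" "j \<in> {0, 1, 2}"
      by (elim insertE emptyE) (force+)
    then have "(1, i, j) \<in> bell_index" by (auto simp: bell_index_def)
    from eq[OF this] show "jet2 c 0 0 s t = 0"
      using \<open>h > 0\<close> \<open>(1, i, j) \<in> bell_index\<close> unfolding ij(1,2) by (simp add: v w bell_dof_sqpoly jet2)
  next
    fix k l :: nat and s t :: real
    assume *: "k \<in> {0, 1}" "l \<in> {0, 1}" "k + l > 0" "s \<in> {0, 1}" "t \<in> {0, 1}"
    then obtain i j where ij: "s = real i" "t = 1 - real j" "i \<in> {0, 1}" "j \<in> {0, 1}"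
      by (elim insertE emptyE) (force+)
    then have in_index: "(2, i, j) \<in> bell_index" "(3, i, j) \<in> bell_index" "(4, i, j) \<in> bell_index"
      by (auto simp: bell_index_def)
    from this[THEN eq] show "jet2 c k l s t = 0"
      using \<open>h > 0\<close> in_index ij * by (auto simp: v w bell_dof_sqpoly jet2)
  qed (use assms(1-3) in \<open>simp_all add: top v w sqpoly_in_W4_iff\<close>)
  then show "v = w"
    unfolding v w by (intro sqpoly_cong) (simp add: c_def)
qed

text \<open>
  In a product \<open>p(u) q(w)\<close> the normal derivatives on the edges are multiples of \<open>q\<close> on the vertical
  and of \<open>p\<close> on the horizontal edges. The Bell condition therefore holds if, whenever a factor is
  a genuine quartic, the other factor has vanishing derivatives at both ends.
\<close>
lemma bell_basis_exists:
  assumes "h > 0" and r: "(l, i, j) \<in> bell_index"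
  shows "\<exists>v \<in> W4 x1 h. \<forall>s \<in> bell_index. bdof x1 h s v = (if s = (l, i, j) then 1 else 0)"
proof -
  let ?\<delta> = "\<lambda>i k. if i = k then 1 else (0::real)"
  let ?ok = "\<lambda>a. sqpoly x1 h a \<in> W4 x1 h \<and>
    (\<forall>s \<in> bell_index. bdof x1 h s (sqpoly x1 h a) = (if s = (l, i, j) then 1 else 0))"
  note dof_simps = bdofs_sqpoly[OF \<open>h > 0\<close>] sqpoly_in_W4_iff[OF \<open>h > 0\<close>]
    jet2_product jet2_lincomb jet_lincomb jet_scale jet_scale_right jet_zero
  consider (1) "l = 1" "i \<in> {0, 1, 2}" "j \<in> {0, 1, 2}" | (2) "l = 2" "i \<in> {0, 1}" "j \<in> {0, 1}"
    | (3) "l = 3" "i \<in> {0, 1}" "j \<in> {0, 1}" | (4) "l = 4" "i \<in> {0, 1}" "j \<in> {0, 1}"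
    using r by (auto simp: bell_index_def)
  then have "\<exists>a. ?ok a"
  proof cases
    case 1
    obtain p where p: "jet p 0 0 = ?\<delta> i 0" "jet p 0 (1/2) = ?\<delta> i 1" "jet p 0 1 = ?\<delta> i 2"
      "jet p 1 0 = 0" "jet p 1 1 = 0" by (rule quartic_interpolation)
    obtain q where q: "jet q 0 0 = ?\<delta> j 2" "jet q 0 (1/2) = ?\<delta> j 1" "jet q 0 1 = ?\<delta> j 0"
      "jet q 1 0 = 0" "jet q 1 1 = 0" by (rule quartic_interpolation)
    have "?ok (\<lambda>i j. p i * q j)"
      using 1 p q by (auto simp: dof_simps simp del: One_nat_def)
    then show ?thesis by (rule exI[of ?ok])
  next
    case 2
    obtain p where p: "jet p 0 0 = 0" "jet p 0 (1/2) = 0" "jet p 0 1 = 0"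
      "jet p 1 0 = h * ?\<delta> i 0" "jet p 1 1 = h * ?\<delta> i 1" by (rule quartic_interpolation)
    obtain q where q: "q 4 = 0" "jet q 0 0 = ?\<delta> j 1" "jet q 0 1 = ?\<delta> j 0"
      "jet q 1 0 = 0" "jet q 1 1 = 0" by (rule cubic_interpolation)
    have "?ok (\<lambda>i j. p i * q j)"
      using 2(2,3) \<open>h > 0\<close>
      by (elim insertE emptyE) (simp_all add: dof_simps 2(1) p q del: One_nat_def)
    then show ?thesis by (rule exI[of ?ok])
  next
    case 3
    obtain p where p: "p 4 = 0" "jet p 0 0 = ?\<delta> i 0" "jet p 0 1 = ?\<delta> i 1"
      "jet p 1 0 = 0" "jet p 1 1 = 0" by (rule cubic_interpolation)
    obtain q where q: "jet q 0 0 = 0" "jet q 0 (1/2) = 0" "jet q 0 1 = 0"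
      "jet q 1 0 = - h * ?\<delta> j 1" "jet q 1 1 = - h * ?\<delta> j 0" by (rule quartic_interpolation)
    have "?ok (\<lambda>i j. p i * q j)"
      using 3(2,3) \<open>h > 0\<close>
      by (elim insertE emptyE) (simp_all add: dof_simps 3(1) p q del: One_nat_def)
    then show ?thesis by (rule exI[of ?ok])
  next
    case 4
    obtain p where p: "p 4 = 0" "jet p 0 0 = 0" "jet p 0 1 = 0"
      "jet p 1 0 = h * ?\<delta> i 0" "jet p 1 1 = h * ?\<delta> i 1" by (rule cubic_interpolation)
    obtain q where q: "q 4 = 0" "jet q 0 0 = 0" "jet q 0 1 = 0"
      "jet q 1 0 = - h * ?\<delta> j 1" "jet q 1 1 = - h * ?\<delta> j 0" by (rule cubic_interpolation)
    obtain b where b: "jet b 0 0 = 0" "jet b 0 (1/2) = 1" "jet b 0 1 = 0"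
      "jet b 1 0 = 0" "jet b 1 1 = 0" by (rule quartic_interpolation)
    \<comment> \<open>The product of the two cubics has all required data except a nonzero value at the centre,
      which a multiple of the centre bubble removes.\<close>
    obtain e where e: "jet p 0 (1/2) * jet q 0 (1/2) + e = 0"
      by (metis add.right_inverse)
    have "?ok (\<lambda>i j. p i * q j + e * (b i * b j))"
      using 4(2,3) \<open>h > 0\<close>
      by (elim insertE emptyE) (simp_all add: dof_simps 4(1) p q b e power2_eq_square del: One_nat_def)
    then show ?thesis by (rule exI[of ?ok])
  qed
  then show ?thesis by blast
qed

lemma bell_basis:
  assumes "h > 0" and r: "(l, i, j) \<in> bell_index"
  shows "bell_basis x1 h l i j \<in> W4 x1 h"
    and "s \<in> bell_index \<Longrightarrow> bdof x1 h s (bell_basis x1 h l i j) = (if s = (l, i, j) then 1 else 0)"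
proof -
  let ?P = "\<lambda>v. v \<in> W4 x1 h \<and> (\<forall>s \<in> bell_index. bdof x1 h s v = (if s = (l, i, j) then 1 else 0))"
  have eq: "bell_basis x1 h l i j = (THE v. ?P v)"
    unfolding bell_basis_def by (rule arg_cong[where f = The]) (auto simp: fun_eq_iff)
  have "\<exists>!v. ?P v"
    using bell_basis_exists[OF assms] W4_eqI[OF \<open>h > 0\<close>] by (metis (mono_tags, lifting))
  then have "?P (bell_basis x1 h l i j)" unfolding eq by (rule theI')
  then show "bell_basis x1 h l i j \<in> W4 x1 h"
    and "s \<in> bell_index \<Longrightarrow> bdof x1 h s (bell_basis x1 h l i j) = (if s = (l, i, j) then 1 else 0)"
    by blast+
qed

section \<open>Quartics determined by fifteen degrees of freedom\<close>

text \<open>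
  The left edge gives the rows \<open>0\<close> and \<open>1\<close> of coefficients, the top edge the columns \<open>0\<close> and \<open>1\<close>;
  total degree at most four leaves only the coefficient of \<open>u\<^sup>2 w\<^sup>2\<close>. That \<open>a 1 4\<close> and \<open>a 4 1\<close>
  vanish by degree is what makes the normal derivatives cubic.
\<close>
lemma quartic_square_eq_0:
  assumes deg: "\<And>i j. i \<le> 4 \<Longrightarrow> j \<le> 4 \<Longrightarrow> 4 < i + j \<Longrightarrow> a i j = 0"
    and corner: "\<And>k l s t. k \<in> {0, 1} \<Longrightarrow> l \<in> {0, 1} \<Longrightarrow> (s, t) \<in> {(0, 0), (1, 0), (0, 1)} \<Longrightarrow>
      jet2 a k l s t = 0"
    and mid: "jet2 a 0 0 0 (1/2) = 0" "jet2 a 0 0 (1/2) 0 = 0" "jet2 a 0 0 1 (1/2) = 0"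
    and "i \<le> 4" "j \<le> 4"
  shows "a i j = 0"
proof -
  have rows: "jet2 a 0 l 0 t = jet (a 0) l t" "jet2 a 1 l 0 t = jet (a 1) l t" for l t
    unfolding jet2_rows jet_at_0 by (rule refl)+
  have columns: "jet2 a k 0 s 0 = jet (\<lambda>i. a i 0) k s" "jet2 a k 1 s 0 = jet (\<lambda>i. a i 1) k s" for k s
    unfolding jet2_columns jet_at_0 by (rule refl)+
  have left: "a 0 j = 0" "a 1 j = 0" if "j \<le> 4" for j
    by (rule quartic_eq_0[OF _ _ _ _ _ that]; unfold rows[symmetric]; use corner mid in auto)
      (rule cubic_eq_0[OF _ _ _ _ _ that]; (unfold rows[symmetric])?; use corner deg in auto)
  have top: "a i 0 = 0" "a i 1 = 0" if "i \<le> 4" for i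
    by (rule quartic_eq_0[OF _ _ _ _ _ that]; unfold columns[symmetric]; use corner mid in auto)
      (rule cubic_eq_0[OF _ _ _ _ _ that]; (unfold columns[symmetric])?; use corner deg in auto)
  have rest: "a i j = 0" if "i \<le> 4" "j \<le> 4" "(i, j) \<noteq> (2, 2)" for i j
  proof (cases "i \<le> 1 \<or> j \<le> 1")
    case True
    then show ?thesis using left top that by (auto simp: le_Suc_eq)
  next
    case False
    then show ?thesis using deg that by auto
  qed
  have "jet2 a 0 0 1 (1/2) = a 2 2 / 4"
    unfolding jet2_def sum_upto_4 by (simp add: rest mono_jet_def power_divide)
  then show ?thesis using mid(3) rest[OF assms(6,7)] by (cases "(i, j) = (2, 2)") auto
qed

lemma quartic_square_interpolation:
  fixes d :: "nat \<Rightarrow> nat \<Rightarrow> real \<Rightarrow> real \<Rightarrow> real"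
  obtains a where "\<forall>i\<le>4. \<forall>j\<le>4. 4 < i + j \<longrightarrow> a i j = 0"
    and "\<forall>k\<in>{0, 1}. \<forall>l\<in>{0, 1}. \<forall>(s, t)\<in>{(0, 0), (1, 0), (0, 1)}. jet2 a k l s t = d k l s t"
    and "jet2 a 0 0 0 (1/2) = d 0 0 0 (1/2)" "jet2 a 0 0 (1/2) 0 = d 0 0 (1/2) 0"
      "jet2 a 0 0 1 (1/2) = d 0 0 1 (1/2)"
proof -
  obtain f0 where f0: "jet f0 0 0 = d 0 0 0 0" "jet f0 0 (1/2) = d 0 0 0 (1/2)" "jet f0 0 1 = d 0 0 0 1"
    "jet f0 1 0 = d 0 1 0 0" "jet f0 1 1 = d 0 1 0 1" by (rule quartic_interpolation)
  obtain f1 where f1: "f1 4 = 0" "jet f1 0 0 = d 1 0 0 0" "jet f1 0 1 = d 1 0 0 1"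
    "jet f1 1 0 = d 1 1 0 0" "jet f1 1 1 = d 1 1 0 1" by (rule cubic_interpolation)
  obtain g0 where g0: "jet g0 0 0 = d 0 0 0 0" "jet g0 0 (1/2) = d 0 0 (1/2) 0" "jet g0 0 1 = d 0 0 1 0"
    "jet g0 1 0 = d 1 0 0 0" "jet g0 1 1 = d 1 0 1 0" by (rule quartic_interpolation)
  obtain g1 where g1: "g1 4 = 0" "jet g1 0 0 = d 0 1 0 0" "jet g1 0 1 = d 0 1 1 0"
    "jet g1 1 0 = d 1 1 0 0" "jet g1 1 1 = d 1 1 1 0" by (rule cubic_interpolation)
  \<comment> \<open>Traces and normal derivatives on the two edges fill rows and columns \<open>0\<close> and \<open>1\<close>; their four
    common entries are the data at the corner, so the two prescriptions are consistent.\<close>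
  define b where "b = (\<lambda>e i j. if i = 0 then f0 j else if i = 1 then f1 j
    else if j = 0 then g0 i else if j = 1 then g1 i else if i = 2 \<and> j = 2 then e else (0::real))"
  have compat: "f0 0 = g0 0" "f0 1 = g1 0" "f1 0 = g0 1" "f1 1 = g1 1"
    using f0(1,4) f1(2,4) g0(1,4) g1(2,4) unfolding jet_at_0 by simp_all
  have b_rows: "b e 0 = f0" "b e 1 = f1" for e by (simp_all add: b_def fun_eq_iff)
  have b_columns: "(\<lambda>i. b e i 0) = g0" "(\<lambda>i. b e i 1) = g1" for e
    using compat by (auto simp: b_def fun_eq_iff)
  have rows: "jet2 (b e) 0 l 0 t = jet f0 l t" "jet2 (b e) 1 l 0 t = jet f1 l t" for e l t
    unfolding jet2_rows jet_at_0 b_rows by (rule refl)+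
  have columns: "jet2 (b e) k 0 s 0 = jet g0 k s" "jet2 (b e) k 1 s 0 = jet g1 k s" for e k s
    unfolding jet2_columns jet_at_0 b_columns by (rule refl)+
  define e where "e = 4 * (d 0 0 1 (1/2) - jet2 (b 0) 0 0 1 (1/2))"
  have "jet2 (b e) 0 0 1 (1/2) = jet2 (b 0) 0 0 1 (1/2) + e / 4"
    unfolding jet2_def sum_upto_4 by (simp add: b_def mono_jet_def power_divide)
  show ?thesis
  proof
    have "b e i j = 0" if "i \<le> 4" "j \<le> 4" "4 < i + j" for i j
      using that f1(1) g1(1) by (cases "i = 4"; cases "j = 4") (auto simp: b_def)
    then show "\<forall>i\<le>4. \<forall>j\<le>4. 4 < i + j \<longrightarrow> b e i j = 0" by blast
    show "\<forall>k\<in>{0, 1}. \<forall>l\<in>{0, 1}. \<forall>(s, t)\<in>{(0, 0), (1, 0), (0, 1)}.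
        jet2 (b e) k l s t = d k l s t"
      by (simp add: rows columns f0 f1 g0 g1 del: One_nat_def)
    show "jet2 (b e) 0 0 0 (1/2) = d 0 0 0 (1/2)" "jet2 (b e) 0 0 (1/2) 0 = d 0 0 (1/2) 0"
      using f0 g0 by (simp_all add: rows columns)
    show "jet2 (b e) 0 0 1 (1/2) = d 0 0 1 (1/2)"
      unfolding \<open>jet2 (b e) 0 0 1 (1/2) = _\<close> by (simp add: e_def field_simps)
  qed
qed

section \<open>Unisolvence of the enriched quartics\<close>

definition serendipity_index :: "(nat \<times> nat \<times> nat) set" where
  "serendipity_index = bell_index - {(1, 1, 1)}"

definition enrichment_index :: "(nat \<times> nat \<times> nat) set" where
  "enrichment_index = {(1, 1, 0), (1, 2, 0), (2, 1, 0), (3, 1, 0), (4, 1, 0)}"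

text \<open>
  The span of a space and five more functions: the first summand keeps its description as
  \<open>P\<^sub>4\<close>, the second becomes a vector of five coefficients.
\<close>
lemma V4_iff:
  "p \<in> V4 x1 h \<longleftrightarrow> (\<exists>q \<in> P_space 4 (square x1 h). \<exists>c.
    p = (\<lambda>z. q z + (\<Sum>r\<in>enrichment_index. c r * (\<lambda>(l, i, j). bell_basis x1 h l i j) r z)))"
proof -
  let ?b = "\<lambda>(l, i, j). bell_basis x1 h l i j"
  have "V4 x1 h = fun_span (P_space 4 (square x1 h) \<union> ?b ` enrichment_index)"
    by (simp add: V4_def enrichment_index_def)
  also have "\<dots> = {u + v | u v. u \<in> P_space 4 (square x1 h) \<and> v \<in> fun_span (?b ` enrichment_index)}"
    unfolding fun_span_def funs.span_Un P_space_def funs.span_span ..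
  also have "fun_span (?b ` enrichment_index) = {\<lambda>z. \<Sum>r\<in>enrichment_index. c r * ?b r z | c. True}"
    by (rule fun_span_finite) (simp add: enrichment_index_def)
  finally have V4: "p \<in> V4 x1 h \<longleftrightarrow> (\<exists>u \<in> P_space 4 (square x1 h). \<exists>c.
      p = u + (\<lambda>z. \<Sum>r\<in>enrichment_index. c r * ?b r z))"
    by blast
  show ?thesis unfolding V4 by (simp add: plus_fun_def)
qed

lemma P4_eqI:
  assumes "h > 0" and p: "p \<in> P_space 4 (square x1 h)" and q: "q \<in> P_space 4 (square x1 h)"
    and eq: "\<And>r. r \<in> serendipity_index - enrichment_index \<Longrightarrow> bdof x1 h r p = bdof x1 h r q"
  shows "p = q"
proof -
  obtain a b where a: "\<forall>i\<le>4. \<forall>j\<le>4. 4 < i + j \<longrightarrow> a i j = 0" "p = sqpoly x1 h a"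
    and b: "\<forall>i\<le>4. \<forall>j\<le>4. 4 < i + j \<longrightarrow> b i j = 0" "q = sqpoly x1 h b"
    using p q unfolding P_space_4[OF \<open>h > 0\<close>] by blast
  define c where "c = (\<lambda>i j. a i j + (- 1) * b i j)"
  have jet2: "jet2 c k l s t = jet2 a k l s t - jet2 b k l s t" for k l s t
    unfolding c_def jet2_lincomb by simp
  have eq': "jet2 c 0 0 (real i / 2) (1 - real j / 2) = 0" if "(1, i, j) \<in> serendipity_index - enrichment_index" for i j
    using eq[OF that] that \<open>h > 0\<close> by (simp add: a b bell_dof_sqpoly serendipity_index_def jet2)
  have eq'': "jet2 c 1 0 (real i) (1 - real j) = 0" "jet2 c 0 1 (real i) (1 - real j) = 0"
    "jet2 c 1 1 (real i) (1 - real j) = 0" if "i \<in> {0, 1}" "j \<in> {0, 1}" "(i, j) \<noteq> (1, 0)" for i j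
  proof -
    have r: "(2, i, j) \<in> serendipity_index - enrichment_index" "(3, i, j) \<in> serendipity_index - enrichment_index"
      "(4, i, j) \<in> serendipity_index - enrichment_index"
      using that by (auto simp: serendipity_index_def enrichment_index_def bell_index_def)
    from r[THEN eq] show "jet2 c 1 0 (real i) (1 - real j) = 0" "jet2 c 0 1 (real i) (1 - real j) = 0"
      "jet2 c 1 1 (real i) (1 - real j) = 0"
      using r \<open>h > 0\<close> by (simp_all add: a b bell_dof_sqpoly serendipity_index_def jet2)
  qed
  have "c i j = 0" if "i \<le> 4" "j \<le> 4" for i j
  proof (rule quartic_square_eq_0[OF _ _ _ _ _ that])
    show "jet2 c 0 0 0 (1/2) = 0" "jet2 c 0 0 (1/2) 0 = 0" "jet2 c 0 0 1 (1/2) = 0"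
      using eq'[of 0 1] eq'[of 1 2] eq'[of 2 1]
      by (simp_all add: serendipity_index_def enrichment_index_def bell_index_def)
    fix k l :: nat and s t :: real
    assume "k \<in> {0, 1}" "l \<in> {0, 1}" "(s, t) \<in> {(0, 0), (1, 0), (0, 1)}"
    then show "jet2 c k l s t = 0"
      using eq'[of 0 2] eq'[of 2 2] eq'[of 0 0] eq''[of 0 1] eq''[of 1 1] eq''[of 0 0]
      by (auto simp: serendipity_index_def enrichment_index_def bell_index_def)
  qed (use a b in \<open>simp add: c_def\<close>)
  then show "p = q"
    unfolding a b by (intro sqpoly_cong) (simp add: c_def)
qed

lemma P4_interpolation:
  fixes D :: "nat \<times> nat \<times> nat \<Rightarrow> real"
  assumes "h > 0"
  shows "\<exists>q \<in> P_space 4 (square x1 h). \<forall>r \<in> serendipity_index - enrichment_index. bdof x1 h r q = D r"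
proof -
  \<comment> \<open>The prescribed jet at the point \<open>(s, t)\<close> in reduced coordinates; the floors recover the index
    of the node from its coordinates, and are exact at the nodes.\<close>
  define d :: "nat \<Rightarrow> nat \<Rightarrow> real \<Rightarrow> real \<Rightarrow> real" where "d k l s t = (if k = 0 \<and> l = 0 then D (1, nat \<lfloor>2 * s\<rfloor>, nat \<lfloor>2 * (1 - t)\<rfloor>)
    else if l = 0 then h * D (2, nat \<lfloor>s\<rfloor>, nat \<lfloor>1 - t\<rfloor>)
    else if k = 0 then - h * D (3, nat \<lfloor>s\<rfloor>, nat \<lfloor>1 - t\<rfloor>)
    else - (h^2) * D (4, nat \<lfloor>s\<rfloor>, nat \<lfloor>1 - t\<rfloor>))" for k l s t
  obtain a where deg: "\<forall>i\<le>4. \<forall>j\<le>4. 4 < i + j \<longrightarrow> a i j = 0"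
    and corner: "\<forall>k\<in>{0, 1}. \<forall>l\<in>{0, 1}. \<forall>(s, t)\<in>{(0, 0), (1, 0), (0, 1)}. jet2 a k l s t = d k l s t"
    and mid: "jet2 a 0 0 0 (1/2) = d 0 0 0 (1/2)" "jet2 a 0 0 (1/2) 0 = d 0 0 (1/2) 0"
      "jet2 a 0 0 1 (1/2) = d 0 0 1 (1/2)"
    by (rule quartic_square_interpolation[of d])
  have "bdof x1 h r (sqpoly x1 h a) = D r" if "r \<in> serendipity_index - enrichment_index" for r
  proof -
    have "r \<in> {1} \<times> {(0, 0), (0, 1), (0, 2), (1, 2), (2, 1), (2, 2)} \<union>
        {2, 3, 4} \<times> {(0, 0), (0, 1), (1, 1)}" "r \<in> bell_index"
      using that by (auto simp: serendipity_index_def enrichment_index_def bell_index_def)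
    then show ?thesis
      using \<open>h > 0\<close> corner by (auto simp: bell_dof_sqpoly mid d_def)
  qed
  moreover have "sqpoly x1 h a \<in> P_space 4 (square x1 h)"
    unfolding P_space_4[OF \<open>h > 0\<close>] using deg by blast
  ultimately show ?thesis by blast
qed

text \<open>
  The fifteen functionals outside the enrichment index vanish on the five added basis functions,
  and the other five are dual to them. So the fifteen fix the quartic part, and the rest fixes the
  coefficients.
\<close>
theorem V4_unisolvent:
  fixes D :: "nat \<times> nat \<times> nat \<Rightarrow> real"
  assumes "h > 0"
  shows "\<exists>!p. p \<in> V4 x1 h \<and> (\<forall>r \<in> serendipity_index. bdof x1 h r p = D r)"
proof -
  let ?N = enrichment_index and ?P = "P_space 4 (square x1 h)"
  let ?b = "\<lambda>(l, i, j). bell_basis x1 h l i j"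
  let ?comb = "\<lambda>q c z. q z + (\<Sum>r\<in>?N. c r * ?b r z)"
  have N: "finite ?N" "?N \<subseteq> serendipity_index" "serendipity_index \<subseteq> bell_index"
    by (auto simp: enrichment_index_def serendipity_index_def bell_index_def)
  have b: "?b s \<in> range (sqpoly x1 h)" "bdof x1 h r (?b s) = (if r = s then 1 else 0)"
    if "s \<in> ?N" "r \<in> bell_index" for r s
  proof -
    obtain l i j where s: "s = (l, i, j)" by (cases s)
    then have "(l, i, j) \<in> bell_index" using that N by blast
    from bell_basis[OF \<open>h > 0\<close> this] show "?b s \<in> range (sqpoly x1 h)"
      "bdof x1 h r (?b s) = (if r = s then 1 else 0)"
      using that s \<open>h > 0\<close> by (auto simp: W4_def Q_space_4)
  qed
  have comb: "bdof x1 h r (?comb q c) = bdof x1 h r q + (if r \<in> ?N then c r else 0)"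
    if "q \<in> ?P" "r \<in> serendipity_index" for q c r
  proof -
    have r: "r \<in> bell_index" using that N by blast
    have "q \<in> range (sqpoly x1 h)" using that(1) \<open>h > 0\<close> by (auto simp: P_space_4)
    then have "bdof x1 h r (?comb q c) = bdof x1 h r q + (\<Sum>s\<in>?N. c s * bdof x1 h r (?b s))"
      using bdof_sum[OF \<open>h > 0\<close> r _ N(1), where f = q and g = ?b and c = c] b(1)[OF _ r] by blast
    also have "(\<Sum>s\<in>?N. c s * bdof x1 h r (?b s)) = (\<Sum>s\<in>?N. if r = s then c s else 0)"
      using b(2)[OF _ r] by (intro sum.cong) auto
    also have "\<dots> = (if r \<in> ?N then c r else 0)" using N(1) by simp
    finally show ?thesis .
  qed
  show ?thesis
  proof (rule ex_ex1I)
    obtain q where q: "q \<in> ?P" "\<forall>r \<in> serendipity_index - ?N. bdof x1 h r q = D r"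
      using P4_interpolation[OF \<open>h > 0\<close>] by blast
    let ?c = "\<lambda>r. D r - bdof x1 h r q"
    have "?comb q ?c \<in> V4 x1 h" 
      unfolding V4_iff by (intro bexI[OF _ q(1)] exI[of _ ?c] refl)
    moreover have "\<forall>r \<in> serendipity_index. bdof x1 h r (?comb q ?c) = D r"
      using comb[OF q(1)] q(2) by simp
    ultimately show "\<exists>p. p \<in> V4 x1 h \<and> (\<forall>r \<in> serendipity_index. bdof x1 h r p = D r)" by blast
  next
    fix p p'
    assume p: "p \<in> V4 x1 h \<and> (\<forall>r \<in> serendipity_index. bdof x1 h r p = D r)"
      and p': "p' \<in> V4 x1 h \<and> (\<forall>r \<in> serendipity_index. bdof x1 h r p' = D r)"
    obtain q c where q: "q \<in> ?P" and pq: "p = ?comb q c" using p unfolding V4_iff by blast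
    obtain q' c' where q': "q' \<in> ?P" and pq': "p' = ?comb q' c'" using p' unfolding V4_iff by blast
    have eq: "bdof x1 h r q + (if r \<in> ?N then c r else 0) = bdof x1 h r q' + (if r \<in> ?N then c' r else 0)"
      if "r \<in> serendipity_index" for r
    proof -
      have "bdof x1 h r p = D r" "bdof x1 h r p' = D r" using p p' that by blast+
      then show ?thesis
        using comb[OF q that, of c, folded pq] comb[OF q' that, of c', folded pq'] by simp
    qed
    have "q = q'"
      using eq by (intro P4_eqI[OF \<open>h > 0\<close> q q']) force
    moreover have "c r = c' r" if "r \<in> ?N" for r
      using eq[of r] that N(2) unfolding \<open>q = q'\<close> by auto
    ultimately show "p = p'"
      unfolding pq pq' by (auto simp: fun_eq_iff intro!: sum.cong)
  qed
qed

theorem lemma2p1: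
  fixes h :: real and x :: "nat \<Rightarrow> real \<times> real" and T :: "(real \<times> real) set"
    and c cx cy cxy m :: "nat \<Rightarrow> real"
  assumes "h > 0"
    and "x 2 = x 1 + h *\<^sub>R (1, 0)"
    and "x 3 = x 1 + h *\<^sub>R (1, 1)"
    and "x 4 = x 1 + h *\<^sub>R (0, 1)"
    and "T = square (x 1) h"
  shows "\<exists>!p. p \<in> V4 (x 1) h \<and>
    (\<forall>i\<in>{1..4}. p (x i) = c i \<and> dx T p (x i) = cx i \<and> dy T p (x i) = cy i \<and> dxy T p (x i) = cxy i) \<and>
    p (midpoint (x 1) (x 2)) = m 1 \<and>
    p (midpoint (x 2) (x 3)) = m 2 \<and>
    p (midpoint (x 4) (x 3)) = m 3 \<and>
    p (midpoint (x 1) (x 4)) = m 4"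
proof -
  let ?corner = "\<lambda>f i j. if i = 0 then (if j = 0 then f 1 else f 4) else (if j = 0 then f 2 else f 3)"
  let ?D = "\<lambda>(l :: nat, i :: nat, j :: nat).
    if l = 1 then
      (if i = 1 then (if j = 0 then m 1 else m 3)
       else if j = 1 then (if i = 2 then m 2 else m 4)
       else ?corner c (i div 2) (j div 2))
    else if l = 2 then ?corner cx i j else if l = 3 then ?corner cy i j else ?corner cxy i j"
  have index: "serendipity_index =
      {1} \<times> {(0, 0), (2, 0), (2, 2), (0, 2), (1, 0), (2, 1), (1, 2), (0, 1)} \<union>
      {2, 3, 4} \<times> {(0, 0), (1, 0), (1, 1), (0, 1)}"
    by (auto simp: serendipity_index_def bell_index_def)
  have mid: "midpoint (x 1) (x 2) = x 1 + (h / 2) *\<^sub>R (1, 0)"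
    "midpoint (x 2) (x 3) = x 1 + (h / 2) *\<^sub>R (2, 1)"
    "midpoint (x 4) (x 3) = x 1 + (h / 2) *\<^sub>R (1, 2)"
    "midpoint (x 1) (x 4) = x 1 + (h / 2) *\<^sub>R (0, 1)"
    unfolding assms midpoint_def by (auto simp: prod_eq_iff algebra_simps)
  have vertices: "{1..4} = {1, 2, 3, 4 :: nat}" by auto
  have "(\<forall>r \<in> serendipity_index. bdof (x 1) h r p = ?D r) \<longleftrightarrow>
    (\<forall>i\<in>{1..4}. p (x i) = c i \<and> dx T p (x i) = cx i \<and> dy T p (x i) = cy i \<and> dxy T p (x i) = cxy i) \<and>
    p (midpoint (x 1) (x 2)) = m 1 \<and>
    p (midpoint (x 2) (x 3)) = m 2 \<and>
    p (midpoint (x 4) (x 3)) = m 3 \<and>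
    p (midpoint (x 1) (x 4)) = m 4" for p
    unfolding mid vertices index
    by (simp add: bell_dof_def assms(2-5) zero_prod_def[where 'a = real and 'b = real, symmetric]) blast
  with V4_unisolvent[OF \<open>h > 0\<close>, of "x 1" ?D] show ?thesis by simp
qed

end
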